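(* Let $\mu_1,\mu_2\in\mathbb{R}$. Each of the three subspaces $L^{2,\mathrm{e,s}}(\mathbb{T}^3)$, $L^{2,\mathrm{e,a_{12}}}(\mathbb{T}^3)$, $L^{2,\mathrm{e,mix}}(\mathbb{T}^3)$ of $L^{2,\mathrm{e}}(\mathbb{T}^3)$ is invariant under the operator $H_{\mu_1\mu_2}(0)$, and hence reduces it.
   Context: $\mathbb{T}^3=(\mathbb{R}/2\pi\mathbb{Z})^3$; $L^{2,\mathrm{e}}(\mathbb{T}^3)$ is the Hilbert space of even functions in $L^2(\mathbb{T}^3)$. The bounded self-adjoint operator $H_{\mu_1\mu_2}(0)=H_0(0)+V_{\mu_1\mu_2}$ on $L^{2,\mathrm{e}}(\mathbb{T}^3)$ is given by $(H_0(0)f)(p)=\mathcal{E}_0(p)f(p)$, $\mathcal{E}_0(p)=4\sum_{i=1}^3(1-\cos p_i)$, and $$(V_{\mu_1\mu_2}f)(p)=\frac{\mu_1}{(2\pi)^3}\int_{\mathbb{T}^3}f(q)\,dq+\frac{2\mu_2}{(2\pi)^3}\sum_{i=1}^3\cos p_i\int_{\mathbb{T}^3}\cos q_i\,f(q)\,dq.$$ Subspaces: $L^{2,\mathrm{e,s}}$ consists of the $f\in L^{2,\mathrm{e}}$ symmetric under all permutations of $(p_1,p_2,p_3)$; $L^{2,\mathrm{e,a_{12}}}$ consists of the $f\in L^{2,\mathrm{e}}$ with $f(p_1,p_2,p_3)=-f(p_2,p_1,p_3)$; $L^{2,\mathrm{e,mix}}$ consists of the $f\in L^{2,\mathrm{e}}$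 with $f(p_1,p_2,p_3)=f(p_2,p_1,p_3)$ and $f=f_1+f_2$ for some $f_1,f_2\in L^{2,\mathrm{e}}$ with $f_1(p_1,p_2,p_3)=-f_1(p_3,p_2,p_1)$, $f_2(p_1,p_2,p_3)=-f_2(p_1,p_3,p_2)$. $L^{2,\mathrm{e}}(\mathbb{T}^3)$ is the orthogonal direct sum of these three subspaces. *)

theory Defs
  imports "HOL-Analysis.Analysis"
begin

text \<open>
  A function on the torus is a function on \<open>real^3\<close> that is 2 pi-periodic in each coordinate.
  Integration over the torus is integration over the cube \<open>[-pi, pi]^3\<close>, a fundamental domain
  up to a null set that is invariant under reflection and coordinate permutations.
  Elements of L2 are given by representatives: all relations between them (evenness,
  symmetries, decompositions) are required almost everywhere, so that every subspace below is
  closed under passing to another representative of the same class.  Restricting to Borel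
  representatives loses no class.
\<close>

definition torus3 :: "(real^3) measure" where
  "torus3 = restrict_space lborel (cbox (\<chi> i. - pi) (\<chi> i. pi))"

definition torus_periodic :: "(real^3 \<Rightarrow> complex) \<Rightarrow> bool" where
  "torus_periodic f \<longleftrightarrow> (\<forall>p i. f (p + axis i (2 * pi)) = f p)"

definition L2 :: "(real^3 \<Rightarrow> complex) set" where
  "L2 = {f. torus_periodic f \<and> f \<in> borel_measurable torus3 \<and>
            integrable torus3 (\<lambda>p. (cmod (f p))\<^sup>2)}"

definition L2_inner :: "(real^3 \<Rightarrow> complex) \<Rightarrow> (real^3 \<Rightarrow> complex) \<Rightarrow> complex" where
  "L2_inner f g = (LINT p|torus3. f p * cnj (g p))"

definition L2_norm :: "(real^3 \<Rightarrow> complex) \<Rightarrow> real" where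
  "L2_norm f = sqrt (LINT p|torus3. (cmod (f p))\<^sup>2)"

definition L2e :: "(real^3 \<Rightarrow> complex) set" where
  "L2e = {f \<in> L2. AE p in torus3. f (- p) = f p}"

definition L2e_s :: "(real^3 \<Rightarrow> complex) set" where
  "L2e_s = {f \<in> L2e. \<forall>\<sigma>. \<sigma> permutes UNIV \<longrightarrow> (AE p in torus3. f (\<chi> i. p $ \<sigma> i) = f p)}"

definition L2e_a12 :: "(real^3 \<Rightarrow> complex) set" where
  "L2e_a12 = {f \<in> L2e. AE p in torus3. f p = - f (vector [p $ 2, p $ 1, p $ 3])}"

definition L2e_mix :: "(real^3 \<Rightarrow> complex) set" where
  "L2e_mix = {f \<in> L2e.
     (AE p in torus3. f p = f (vector [p $ 2, p $ 1, p $ 3])) \<and>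
     (\<exists>f1\<in>L2e. \<exists>f2\<in>L2e.
        (AE p in torus3. f p = f1 p + f2 p) \<and>
        (AE p in torus3. f1 p = - f1 (vector [p $ 3, p $ 2, p $ 1])) \<and>
        (AE p in torus3. f2 p = - f2 (vector [p $ 1, p $ 3, p $ 2])))}"

definition E0 :: "real^3 \<Rightarrow> real" where
  "E0 p = 4 * (\<Sum>i\<in>UNIV. 1 - cos (p $ i))"

definition H0 :: "(real^3 \<Rightarrow> complex) \<Rightarrow> real^3 \<Rightarrow> complex" where
  "H0 f p = complex_of_real (E0 p) * f p"

definition V :: "real \<Rightarrow> real \<Rightarrow> (real^3 \<Rightarrow> complex) \<Rightarrow> real^3 \<Rightarrow> complex" where
  "V \<mu>1 \<mu>2 f p =
     complex_of_real (\<mu>1 / (2 * pi) ^ 3) * (LINT q|torus3. f q) +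
     complex_of_real (2 * \<mu>2 / (2 * pi) ^ 3) *
       (\<Sum>i\<in>UNIV. complex_of_real (cos (p $ i)) *
          (LINT q|torus3. complex_of_real (cos (q $ i)) * f q))"

definition H :: "real \<Rightarrow> real \<Rightarrow> (real^3 \<Rightarrow> complex) \<Rightarrow> real^3 \<Rightarrow> complex" where
  "H \<mu>1 \<mu>2 f p = H0 f p + V \<mu>1 \<mu>2 f p"

definition closed_subspace_L2e :: "(real^3 \<Rightarrow> complex) set \<Rightarrow> bool" where
  "closed_subspace_L2e M \<longleftrightarrow>
     M \<subseteq> L2e \<and> (\<lambda>p. 0) \<in> M \<and>
     (\<forall>f\<in>M. \<forall>g\<in>M. (\<lambda>p. f p + g p) \<in> M) \<and>
     (\<forall>c. \<forall>f\<in>M. (\<lambda>p. c * f p) \<in> M) \<and>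
     (\<forall>F. \<forall>f\<in>L2e. (\<forall>n. F n \<in> M) \<and> (\<lambda>n. L2_norm (\<lambda>p. F n p - f p)) \<longlonglongrightarrow> 0 \<longrightarrow> f \<in> M)"

definition orth_compl_L2e :: "(real^3 \<Rightarrow> complex) set \<Rightarrow> (real^3 \<Rightarrow> complex) set" where
  "orth_compl_L2e M = {g \<in> L2e. \<forall>f\<in>M. L2_inner f g = 0}"

definition invariant_under ::
    "((real^3 \<Rightarrow> complex) \<Rightarrow> (real^3 \<Rightarrow> complex)) \<Rightarrow> (real^3 \<Rightarrow> complex) set \<Rightarrow> bool" where
  "invariant_under A M \<longleftrightarrow> (\<forall>f\<in>M. A f \<in> M)"

text \<open>
  A closed subspace reduces a bounded operator on the Hilbert space of even functions if it and
  its orthogonal complement (taken in that space) are both invariant.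
\<close>

definition reduces ::
    "(real^3 \<Rightarrow> complex) set \<Rightarrow> ((real^3 \<Rightarrow> complex) \<Rightarrow> (real^3 \<Rightarrow> complex)) \<Rightarrow> bool" where
  "reduces M A \<longleftrightarrow> closed_subspace_L2e M \<and>
     invariant_under A M \<and> invariant_under A (orth_compl_L2e M)"

end

theory Submission
  imports Defs
begin

text \<open>
  The operator \<open>H\<close> is linear and commutes with permutations of the coordinates, because these
  preserve the measure and permute the functions \<open>cos p\<^sub>i\<close>.  Hence it preserves every subspace
  described by linear relations between a function and its permuted copies.  Such a subspace is
  closed, and since \<open>H\<close> is self-adjoint, its orthogonal complement is invariant as well.
\<close>

section \<open>Coordinate permutations and the measure on the torus\<close>

definition permute_coords :: "('n \<Rightarrow> 'n) \<Rightarrow> real^'n \<Rightarrow> real^'n" where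
  "permute_coords \<sigma> p = (\<chi> i. p $ \<sigma> i)"

lemma permute_coords_nth [simp]: "permute_coords \<sigma> p $ i = p $ \<sigma> i"
  by (simp add: permute_coords_def)

text \<open>Links the explicit vectors in \<open>L2e_a12\<close> and \<open>L2e_mix\<close> to
  \<open>permute_coords\<close>, so that one theory of bijections of the index set serves all three
  subspaces.\<close>

lemma permute_coords_transpose:
  "permute_coords (Transposition.transpose 1 2) (p :: real^3) = vector [p $ 2, p $ 1, p $ 3]"
  "permute_coords (Transposition.transpose 1 3) (p :: real^3) = vector [p $ 3, p $ 2, p $ 1]"
  "permute_coords (Transposition.transpose 2 3) (p :: real^3) = vector [p $ 1, p $ 3, p $ 2]"
  by (simp_all add: vec_eq_iff forall_3 Transposition.transpose_def)

lemma borel_measurable_permute_coords [measurable]: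
  "permute_coords \<sigma> \<in> borel_measurable (borel :: (real^'n) measure)"
  unfolding permute_coords_def
  by (intro borel_measurable_continuous_onI continuous_on_vec_lambda continuous_intros)

lemma prod_Basis_cart:
  fixes f :: "real^'n \<Rightarrow> 'a::comm_monoid_mult"
  shows "(\<Prod>b\<in>Basis. f b) = (\<Prod>i\<in>UNIV. f (axis i 1))"
proof -
  have Basis: "(Basis :: (real^'n) set) = (\<lambda>i. axis i 1) ` UNIV"
    by (auto simp: Basis_vec_def)
  have "inj (\<lambda>i. axis i (1::real) :: real^'n)"
    by (auto simp: inj_on_def axis_eq_axis)
  then show ?thesis
    unfolding Basis by (subst prod.reindex) simp_all
qed

text \<open>The condition on \<open>p $ \<sigma> i\<close> bounded by the corner entries at
  \<open>i\<close> is a condition on \<open>p $ j\<close> with bounds at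
  \<open>inv \<sigma> j\<close>; hence the inverse permutation on the corners.\<close>

lemma vimage_permute_coords_box:
  assumes "bij \<sigma>"
  shows "permute_coords \<sigma> -` box l u =
    box (permute_coords (inv \<sigma>) l) (permute_coords (inv \<sigma>) (u :: real^'n))"
proof -
  have "(\<forall>i. l $ i < p $ \<sigma> i \<and> p $ \<sigma> i < u $ i) \<longleftrightarrow>
      (\<forall>i. l $ inv \<sigma> i < p $ i \<and> p $ i < u $ inv \<sigma> i)" for p :: "real^'n"
    by (metis assms bij_inv_eq_iff)
  then show ?thesis
    by (auto simp: mem_box_cart)
qed

text \<open>Lebesgue measure is determined by its values on boxes, and permuting the sides of a box
  does not change the product of their lengths.\<close>

lemma lborel_distr_permute_coords:
  assumes "bij \<sigma>"
  shows "distr lborel borel (permute_coords \<sigma>) = (lborel :: (real^'n) measure)"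
proof (rule lborel_eqI[symmetric])
  fix l u :: "real^'n" assume le: "\<And>b. b \<in> Basis \<Longrightarrow> l \<bullet> b \<le> u \<bullet> b"
  have nth_le: "l $ i \<le> u $ i" for i
    using le[of "axis i 1"] by (simp add: inner_axis)
  have "emeasure (distr lborel borel (permute_coords \<sigma>)) (box l u) =
      emeasure lborel (box (permute_coords (inv \<sigma>) l) (permute_coords (inv \<sigma>) u))"
    by (simp add: emeasure_distr vimage_permute_coords_box[OF assms])
  also have "\<dots> = (\<Prod>b\<in>Basis. (permute_coords (inv \<sigma>) u - permute_coords (inv \<sigma>) l) \<bullet> b)"
    by (rule emeasure_lborel_box) (auto simp: Basis_vec_def inner_axis nth_le)
  also have "(\<Prod>b\<in>Basis. (permute_coords (inv \<sigma>) u - permute_coords (inv \<sigma>) l) \<bullet> b) =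
      (\<Prod>i\<in>UNIV. (u - l) $ inv \<sigma> i)"
    by (simp add: prod_Basis_cart inner_axis)
  also have "\<dots> = (\<Prod>i\<in>UNIV. (u - l) $ i)"
    using bij_imp_bij_inv[OF assms] by (rule prod.reindex_bij_betw)
  also have "\<dots> = (\<Prod>b\<in>Basis. (u - l) \<bullet> b)"
    by (simp add: prod_Basis_cart inner_axis)
  finally show "emeasure (distr lborel borel (permute_coords \<sigma>)) (box l u) =
    (\<Prod>b\<in>Basis. (u - l) \<bullet> b)" .
qed simp

lemma permute_coords_in_cube_iff:
  assumes "bij \<sigma>"
  shows "permute_coords \<sigma> p \<in> cbox (\<chi> i. a) (\<chi> i. b) \<longleftrightarrow> p \<in> cbox (\<chi> i. a) (\<chi> i. b)"
  using assms by (simp add: mem_box_cart) (metis bij_inv_eq_iff)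

lemma space_torus3: "space torus3 = cbox (\<chi> i. - pi) (\<chi> i. pi)"
  by (simp add: torus3_def space_restrict_space)

lemma borel_measurable_torus3: "f \<in> borel_measurable borel \<Longrightarrow> f \<in> borel_measurable torus3"
  by (simp add: torus3_def measurable_restrict_space1)

lemma measurable_permute_coords_torus3:
  assumes "bij \<sigma>"
  shows "permute_coords \<sigma> \<in> measurable torus3 torus3"
  unfolding torus3_def
  by (intro measurable_restrict_space2 measurable_restrict_space1)
    (auto simp: space_restrict_space permute_coords_in_cube_iff[OF assms])

text \<open>The cube has equal sides, so the preimage of a subset of the cube stays in the cube, and
  invariance is inherited from Lebesgue measure on the whole space.\<close>

lemma torus3_distr_permute_coords:
  assumes "bij \<sigma>"
  shows "distr torus3 torus3 (permute_coords \<sigma>) = torus3"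
proof (rule measure_eqI)
  fix A assume "A \<in> sets (distr torus3 torus3 (permute_coords \<sigma>))"
  then have A: "A \<in> sets torus3" "A \<in> sets borel" "A \<subseteq> cbox (\<chi> i. - pi) (\<chi> i. pi)"
    by (auto simp: torus3_def sets_restrict_space)
  have "emeasure (distr torus3 torus3 (permute_coords \<sigma>)) A =
      emeasure torus3 (permute_coords \<sigma> -` A \<inter> space torus3)"
    by (rule emeasure_distr[OF measurable_permute_coords_torus3[OF assms] A(1)])
  also have "permute_coords \<sigma> -` A \<inter> space torus3 = permute_coords \<sigma> -` A"
    using A(3) by (auto simp: space_torus3 permute_coords_in_cube_iff[OF assms])
  also have "emeasure torus3 (permute_coords \<sigma> -` A) = emeasure lborel (permute_coords \<sigma> -` A)"
    unfolding torus3_def using A(3)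
    by (intro emeasure_restrict_space) (auto simp: permute_coords_in_cube_iff[OF assms])
  also have "\<dots> = emeasure (distr lborel borel (permute_coords \<sigma>)) A"
    using A(2) by (simp add: emeasure_distr)
  also have "\<dots> = emeasure torus3 A"
    unfolding torus3_def lborel_distr_permute_coords[OF assms] using A(3)
    by (intro emeasure_restrict_space[symmetric]) auto
  finally show "emeasure (distr torus3 torus3 (permute_coords \<sigma>)) A = emeasure torus3 A" .
qed simp

lemma AE_torus3_permute_coords:
  assumes "bij \<sigma>" "AE p in torus3. P p"
  shows "AE p in torus3. P (permute_coords \<sigma> p)"
  using AE_distrD[OF measurable_permute_coords_torus3] assms torus3_distr_permute_coords by metis

lemma integrable_torus3_permute_coords:
  fixes f :: "real^3 \<Rightarrow> 'b::{banach, second_countable_topology}"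
  assumes "bij \<sigma>" "integrable torus3 f"
  shows "integrable torus3 (\<lambda>p. f (permute_coords \<sigma> p))"
  using integrable_distr[OF measurable_permute_coords_torus3[OF assms(1)]] assms
  by (simp add: torus3_distr_permute_coords)

lemma integral_torus3_permute_coords:
  fixes f :: "real^3 \<Rightarrow> 'b::{banach, second_countable_topology}"
  assumes "bij \<sigma>" "f \<in> borel_measurable torus3"
  shows "(LINT p|torus3. f (permute_coords \<sigma> p)) = (LINT p|torus3. f p)"
  using integral_distr[OF measurable_permute_coords_torus3[OF assms(1)] assms(2)]
  by (simp add: torus3_distr_permute_coords assms(1))

section \<open>Square-integrable functions on the torus\<close>

lemma finite_measure_torus3: "finite_measure torus3"
  by (rule finite_measureI)
    (simp add: torus3_def space_restrict_space emeasure_restrict_space emeasure_lborel_cbox_eq)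

lemma integrable_torus3_const [simp]:
  "integrable torus3 (\<lambda>p. c :: 'b::{banach, second_countable_topology})"
  by (rule finite_measure.integrable_const[OF finite_measure_torus3])

text \<open>Elementary substitute for the triangle inequality in L2: it controls sums of two
  functions and, later, the three terms of a symmetry relation.\<close>

lemma cmod_add3_squared_le:
  "(cmod (x + y + z))\<^sup>2 \<le> 3 * ((cmod x)\<^sup>2 + (cmod y)\<^sup>2 + (cmod z)\<^sup>2)"
proof -
  have "(cmod (x + y + z))\<^sup>2 \<le> (cmod x + cmod y + cmod z)\<^sup>2"
    by (intro power_mono norm_triangle_le add_mono order_refl norm_triangle_ineq) simp
  also have "\<dots> \<le> 3 * ((cmod x)\<^sup>2 + (cmod y)\<^sup>2 + (cmod z)\<^sup>2)"
    \<comment> \<open>The right side minus the left is the sum of the squares of the three pairwise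
      differences.\<close>
    using sum_squares_ge_zero[of "cmod x - cmod y" "cmod x - cmod z"]
      zero_le_square[of "cmod y - cmod z"]
    by (simp add: power2_eq_square algebra_simps)
  finally show ?thesis .
qed

lemma L2_measurable: "f \<in> L2 \<Longrightarrow> f \<in> borel_measurable torus3"
  by (simp add: L2_def)

lemma L2_integrable_square: "f \<in> L2 \<Longrightarrow> integrable torus3 (\<lambda>p. (cmod (f p))\<^sup>2)"
  by (simp add: L2_def)

lemma L2_zero: "(\<lambda>p. 0) \<in> L2"
  by (simp add: L2_def torus_periodic_def)

lemma L2_add:
  assumes "f \<in> L2" "g \<in> L2"
  shows "(\<lambda>p. f p + g p) \<in> L2"
proof -
  note [measurable] = L2_measurable[OF assms(1)] L2_measurable[OF assms(2)]
  have "integrable torus3 (\<lambda>p. (cmod (f p + g p))\<^sup>2)"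
  proof (rule Bochner_Integration.integrable_bound)
    show "integrable torus3 (\<lambda>p. 3 * ((cmod (f p))\<^sup>2 + (cmod (g p))\<^sup>2))"
      using assms by (intro integrable_mult_right Bochner_Integration.integrable_add L2_integrable_square)
    show "AE p in torus3. norm ((cmod (f p + g p))\<^sup>2) \<le>
        norm (3 * ((cmod (f p))\<^sup>2 + (cmod (g p))\<^sup>2))"
      using cmod_add3_squared_le[of "f p" "g p" 0 for p] by simp
  qed measurable
  then show ?thesis
    using assms by (simp add: L2_def torus_periodic_def)
qed

text \<open>Common source for multiplication by constants and by cosines; periodicity of the factor
  keeps the product a function on the torus.\<close>

lemma L2_mult_bounded:
  assumes "f \<in> L2" "torus_periodic g" "g \<in> borel_measurable torus3" "\<And>p. cmod (g p) \<le> B"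
  shows "(\<lambda>p. g p * f p) \<in> L2"
proof -
  note [measurable] = L2_measurable[OF assms(1)] assms(3)
  have "integrable torus3 (\<lambda>p. (cmod (g p * f p))\<^sup>2)"
  proof (rule Bochner_Integration.integrable_bound)
    show "integrable torus3 (\<lambda>p. B\<^sup>2 * (cmod (f p))\<^sup>2)"
      using assms(1) by (intro integrable_mult_right L2_integrable_square)
    show "AE p in torus3. norm ((cmod (g p * f p))\<^sup>2) \<le> norm (B\<^sup>2 * (cmod (f p))\<^sup>2)"
      using assms(4) by (auto simp: norm_mult power_mult_distrib intro!: mult_right_mono power_mono)
  qed measurable
  then show ?thesis
    using assms by (simp add: L2_def torus_periodic_def)
qed

lemma L2_const_mult: "f \<in> L2 \<Longrightarrow> (\<lambda>p. c * f p) \<in> L2"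
  by (rule L2_mult_bounded[where g = "\<lambda>p. c" and B = "cmod c"]) (simp_all add: torus_periodic_def)

lemma L2_permute_coords:
  assumes "bij \<sigma>" "f \<in> L2"
  shows "(\<lambda>p. f (permute_coords \<sigma> p)) \<in> L2"
proof -
  \<comment> \<open>The coordinate of the permuted point that reads entry \<open>i\<close> is
    \<open>inv \<sigma> i\<close>, so a period shift remains a period shift.\<close>
  have "permute_coords \<sigma> (p + axis i (2 * pi)) =
      permute_coords \<sigma> p + axis (inv \<sigma> i) (2 * pi)" for p :: "real^3" and i
    using assms(1) by (auto simp: vec_eq_iff axis_def bij_inv_eq_iff)
  then have "torus_periodic (\<lambda>p. f (permute_coords \<sigma> p))"
    using assms(2) by (simp add: L2_def torus_periodic_def)
  moreover have "(\<lambda>p. f (permute_coords \<sigma> p)) \<in> borel_measurable torus3"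
    using measurable_compose[OF measurable_permute_coords_torus3[OF assms(1)]
        L2_measurable[OF assms(2)]] .
  ultimately show ?thesis
    using integrable_torus3_permute_coords[OF assms(1) L2_integrable_square[OF assms(2)]]
    by (simp add: L2_def)
qed

text \<open>The torus has finite measure, so 1 plus the squared modulus is an integrable majorant.
  This makes the integrals in \<open>V\<close> additive on \<open>L2\<close>.\<close>

lemma L2_integrable:
  assumes "f \<in> L2"
  shows "integrable torus3 f"
proof (rule Bochner_Integration.integrable_bound)
  show "integrable torus3 (\<lambda>p. 1 + (cmod (f p))\<^sup>2)"
    using assms by (intro Bochner_Integration.integrable_add L2_integrable_square) simp_all
  have "x \<le> 1 + x\<^sup>2" for x :: real
    using zero_le_power2[of "x - 1/2"] by (simp add: power2_eq_square algebra_simps)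
  then show "AE p in torus3. norm (f p) \<le> norm (1 + (cmod (f p))\<^sup>2)"
    by simp
qed (rule L2_measurable[OF assms])

lemma L2_integrable_mult_cnj:
  assumes "f \<in> L2" "g \<in> L2"
  shows "integrable torus3 (\<lambda>p. f p * cnj (g p))"
proof (rule Bochner_Integration.integrable_bound)
  note [measurable] = L2_measurable[OF assms(1)] L2_measurable[OF assms(2)]
  show "integrable torus3 (\<lambda>p. (cmod (f p))\<^sup>2 + (cmod (g p))\<^sup>2)"
    using assms by (intro Bochner_Integration.integrable_add L2_integrable_square)
  have [measurable]: "(\<lambda>p. cnj (g p)) \<in> borel_measurable torus3"
    using L2_integrable[OF assms(2)] by (intro borel_measurable_integrable) simp
  show "(\<lambda>p. f p * cnj (g p)) \<in> borel_measurable torus3"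
    by measurable
  have "x * y \<le> x\<^sup>2 + y\<^sup>2" if "0 \<le> x" "0 \<le> y" for x y :: real
    using zero_le_power2[of "x - y"] mult_nonneg_nonneg[OF that]
    by (simp add: power2_eq_square algebra_simps)
  then show "AE p in torus3. norm (f p * cnj (g p)) \<le> norm ((cmod (f p))\<^sup>2 + (cmod (g p))\<^sup>2)"
    by (simp add: norm_mult)
qed

section \<open>Even functions\<close>

lemma L2e_subset_L2: "L2e \<subseteq> L2"
  by (auto simp: L2e_def)

lemma L2e_zero: "(\<lambda>p. 0) \<in> L2e"
  by (simp add: L2e_def L2_zero)

lemma L2e_add: "f \<in> L2e \<Longrightarrow> g \<in> L2e \<Longrightarrow> (\<lambda>p. f p + g p) \<in> L2e"
  by (auto simp: L2e_def L2_add)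

lemma L2e_const_mult: "f \<in> L2e \<Longrightarrow> (\<lambda>p. c * f p) \<in> L2e"
  by (auto simp: L2e_def L2_const_mult)

lemma L2e_permute_coords:
  assumes "bij \<sigma>" "f \<in> L2e"
  shows "(\<lambda>p. f (permute_coords \<sigma> p)) \<in> L2e"
proof -
  have "permute_coords \<sigma> (- p) = - permute_coords \<sigma> p" for p :: "real^3"
    by (simp add: vec_eq_iff)
  then show ?thesis
    using assms AE_torus3_permute_coords[OF assms(1), of "\<lambda>p. f (- p) = f p"]
    by (simp add: L2e_def L2_permute_coords)
qed

section \<open>The operator preserves square integrability and evenness\<close>

lemma torus_periodic_cos: "torus_periodic (\<lambda>p. complex_of_real (cos (p $ i)))"
  by (auto simp: torus_periodic_def axis_def)

lemma borel_measurable_cos_nth: "(\<lambda>p :: real^3. complex_of_real (cos (p $ i))) \<in> borel_measurable torus3"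
  by (intro borel_measurable_torus3 borel_measurable_continuous_onI continuous_intros)

lemma L2_cos_mult: "f \<in> L2 \<Longrightarrow> (\<lambda>p. complex_of_real (cos (p $ i)) * f p) \<in> L2"
  by (rule L2_mult_bounded[where B = 1]) (simp_all add: torus_periodic_cos borel_measurable_cos_nth)

lemma L2_H0:
  assumes "f \<in> L2"
  shows "H0 f \<in> L2"
proof -
  \<comment> \<open>The constant 12 is 4 times the three ones in \<open>E0\<close>; the sum is
    grouped so that the closure rules of \<open>L2\<close> apply term by term.\<close>
  have eq: "H0 f = (\<lambda>p. 12 * f p + ((- 4) * (complex_of_real (cos (p $ 1)) * f p)
      + ((- 4) * (complex_of_real (cos (p $ 2)) * f p)
      + (- 4) * (complex_of_real (cos (p $ 3)) * f p))))"
    by (simp add: fun_eq_iff H0_def E0_def sum_3 algebra_simps)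
  show ?thesis
    unfolding eq by (intro L2_add L2_const_mult L2_cos_mult assms)
qed

lemma L2_one: "(\<lambda>p. 1) \<in> L2"
  by (simp add: L2_def torus_periodic_def)

text \<open>The integrals of \<open>f\<close> enter only as coefficients of a linear combination of
  1 and the three cosines, all of which lie in \<open>L2\<close>.\<close>

lemma L2_V: "V \<mu>1 \<mu>2 f \<in> L2"
proof -
  define m where "m = complex_of_real (\<mu>1 / (2 * pi) ^ 3) * (LINT q|torus3. f q)"
  define d where "d i = complex_of_real (2 * \<mu>2 / (2 * pi) ^ 3) *
    (LINT q|torus3. complex_of_real (cos (q $ i)) * f q)" for i
  have eq: "V \<mu>1 \<mu>2 f = (\<lambda>p. m * 1 + (d 1 * (complex_of_real (cos (p $ 1)) * 1)
      + (d 2 * (complex_of_real (cos (p $ 2)) * 1) + d 3 * (complex_of_real (cos (p $ 3)) * 1))))"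
    by (simp add: fun_eq_iff V_def m_def d_def sum_3 algebra_simps)
  show ?thesis
    unfolding eq by (intro L2_add L2_const_mult L2_cos_mult L2_one)
qed

lemma L2_H: "f \<in> L2 \<Longrightarrow> H \<mu>1 \<mu>2 f \<in> L2"
  using L2_add[OF L2_H0 L2_V] by (simp add: H_def[abs_def])

lemma L2e_H:
  assumes "f \<in> L2e"
  shows "H \<mu>1 \<mu>2 f \<in> L2e"
proof -
  have "AE p in torus3. f (- p) = f p"
    using assms by (simp add: L2e_def)
  then have "AE p in torus3. H \<mu>1 \<mu>2 f (- p) = H \<mu>1 \<mu>2 f p"
    by eventually_elim (simp add: H_def H0_def E0_def V_def)
  then show ?thesis
    using assms L2_H by (auto simp: L2e_def)
qed

section \<open>Linearity and commutation with permutations\<close>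

lemma V_add:
  assumes "f \<in> L2" "g \<in> L2"
  shows "V \<mu>1 \<mu>2 (\<lambda>p. f p + g p) p = V \<mu>1 \<mu>2 f p + V \<mu>1 \<mu>2 g p"
  using assms
  by (simp add: V_def distrib_left L2_integrable L2_cos_mult sum.distrib)

lemma V_const_mult: "V \<mu>1 \<mu>2 (\<lambda>p. c * f p) p = c * V \<mu>1 \<mu>2 f p"
  by (simp add: V_def mult.left_commute[of _ c] sum_distrib_left[symmetric] distrib_left)

text \<open>By invariance of the measure, permuting \<open>f\<close> moves its cosine integral from
  index \<open>i\<close> to \<open>\<sigma> i\<close>; reindexing the sum transfers this shift to
  the factor \<open>cos (p $ \<sigma> i)\<close>.\<close>

lemma V_permute_coords:
  assumes "bij \<sigma>" "f \<in> L2"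
  shows "V \<mu>1 \<mu>2 (\<lambda>p. f (permute_coords \<sigma> p)) p = V \<mu>1 \<mu>2 f (permute_coords \<sigma> p)"
proof -
  let ?C = "\<lambda>i f. LINT q|torus3. complex_of_real (cos (q $ i)) * f q"
  have C: "?C (\<sigma> i) (\<lambda>p. f (permute_coords \<sigma> p)) = ?C i f" for i
    using integral_torus3_permute_coords[OF assms(1) L2_measurable[OF L2_cos_mult[OF assms(2)]]]
    by simp
  have "(\<Sum>i\<in>UNIV. complex_of_real (cos (p $ i)) * ?C i (\<lambda>p. f (permute_coords \<sigma> p))) =
      (\<Sum>i\<in>UNIV. complex_of_real (cos (p $ \<sigma> i)) * ?C (\<sigma> i) (\<lambda>p. f (permute_coords \<sigma> p)))"
    using assms(1) by (rule sum.reindex_bij_betw[symmetric])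
  then show ?thesis
    by (simp add: V_def C integral_torus3_permute_coords[OF assms(1) L2_measurable[OF assms(2)]])
qed

lemma E0_permute_coords: "bij \<sigma> \<Longrightarrow> E0 (permute_coords \<sigma> p) = E0 p"
  unfolding E0_def permute_coords_nth
  by (simp add: sum.reindex_bij_betw[of \<sigma> UNIV UNIV "\<lambda>i. 1 - cos (p $ i)"])

text \<open>Integrals ignore null sets. This lets relations that hold only almost everywhere pass
  through \<open>H\<close>.\<close>

lemma V_eq_zero:
  assumes "f \<in> L2" "AE p in torus3. f p = 0"
  shows "V \<mu>1 \<mu>2 f p = 0"
proof -
  have "(LINT q|torus3. f q) = 0"
    using assms(2) by (rule integral_eq_zero_AE)
  moreover have "(LINT q|torus3. complex_of_real (cos (q $ i)) * f q) = 0" for i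
    using assms(2) by (intro integral_eq_zero_AE) auto
  ultimately show ?thesis
    by (simp add: V_def)
qed

section \<open>Self-adjointness and reduction\<close>

lemma L2_inner_commute: "L2_inner f g = cnj (L2_inner g f)"
  by (simp add: L2_inner_def Bochner_Integration.integral_cnj[symmetric] mult.commute
      del: Bochner_Integration.integral_cnj)

lemma L2_inner_add_left:
  "f \<in> L2 \<Longrightarrow> g \<in> L2 \<Longrightarrow> h \<in> L2 \<Longrightarrow>
    L2_inner (\<lambda>p. f p + g p) h = L2_inner f h + L2_inner g h"
  by (simp add: L2_inner_def distrib_right L2_integrable_mult_cnj)

text \<open>In this form the symmetry of \<open>V\<close> is visible: the outer coefficients are
  real, so exchanging \<open>f\<close> and \<open>g\<close> conjugates the right side.\<close>

lemma L2_inner_V: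
  assumes "g \<in> L2"
  shows "L2_inner (V \<mu>1 \<mu>2 f) g =
    complex_of_real (\<mu>1 / (2 * pi) ^ 3) * (LINT q|torus3. f q) * cnj (LINT q|torus3. g q) +
    complex_of_real (2 * \<mu>2 / (2 * pi) ^ 3) *
      (\<Sum>i\<in>UNIV. (LINT q|torus3. complex_of_real (cos (q $ i)) * f q) *
         cnj (LINT q|torus3. complex_of_real (cos (q $ i)) * g q))"
proof -
  define m where "m = complex_of_real (\<mu>1 / (2 * pi) ^ 3) * (LINT q|torus3. f q)"
  define n where "n = complex_of_real (2 * \<mu>2 / (2 * pi) ^ 3)"
  define d where "d i = (LINT q|torus3. complex_of_real (cos (q $ i)) * f q)" for i
  have int: "integrable torus3 (\<lambda>p. cnj (g p))"
    "integrable torus3 (\<lambda>p. cnj (complex_of_real (cos (p $ i)) * g p))" for i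
    using assms by (simp_all only: integrable_cnj L2_integrable L2_cos_mult)
  have "L2_inner (V \<mu>1 \<mu>2 f) g = (LINT p|torus3. m * cnj (g p) +
      n * (\<Sum>i\<in>UNIV. d i * cnj (complex_of_real (cos (p $ i)) * g p)))"
    by (simp add: L2_inner_def V_def m_def n_def d_def sum_distrib_left sum_distrib_right
        algebra_simps)
  also have "\<dots> = m * cnj (LINT q|torus3. g q) +
      n * (\<Sum>i\<in>UNIV. d i * cnj (LINT q|torus3. complex_of_real (cos (q $ i)) * g q))"
    \<comment> \<open>The conjugate of the product is kept whole so that the integrands match the
      facts in \<open>int\<close>.\<close>
    using int by (simp del: complex_cnj_mult)
  finally show ?thesis
    by (simp add: m_def n_def d_def)
qed

text \<open>\<open>H0\<close> multiplies by a real function and the form of \<open>V\<close> is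
  Hermitian, so both parts are symmetric.\<close>

lemma L2_inner_H:
  assumes "f \<in> L2" "g \<in> L2"
  shows "L2_inner (H \<mu>1 \<mu>2 f) g = L2_inner f (H \<mu>1 \<mu>2 g)"
proof -
  have H: "L2_inner (H \<mu>1 \<mu>2 f) g = L2_inner (H0 f) g + L2_inner (V \<mu>1 \<mu>2 f) g"
    if "f \<in> L2" "g \<in> L2" for f g
    unfolding H_def[abs_def] using that by (intro L2_inner_add_left L2_H0 L2_V)
  have "L2_inner (H0 f) g = cnj (L2_inner (H0 g) f)"
    by (subst L2_inner_commute[symmetric]) (simp add: L2_inner_def H0_def ac_simps)
  moreover have "L2_inner (V \<mu>1 \<mu>2 f) g = cnj (L2_inner (V \<mu>1 \<mu>2 g) f)"
    using assms by (simp add: L2_inner_V ac_simps)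
  ultimately have "L2_inner (H \<mu>1 \<mu>2 f) g = cnj (L2_inner (H \<mu>1 \<mu>2 g) f)"
    using assms by (simp add: H)
  then show ?thesis
    by (simp add: L2_inner_commute[of f])
qed

text \<open>For \<open>f\<close> in \<open>M\<close> and \<open>g\<close> orthogonal to
  \<open>M\<close>, symmetry moves \<open>H\<close> onto \<open>f\<close>, and
  \<open>H \<mu>1 \<mu>2 f\<close> is again in \<open>M\<close>.\<close>

lemma reduces_H:
  assumes "closed_subspace_L2e M" "invariant_under (H \<mu>1 \<mu>2) M"
  shows "reduces M (H \<mu>1 \<mu>2)"
proof -
  have "L2_inner f (H \<mu>1 \<mu>2 g) = 0" if "g \<in> orth_compl_L2e M" "f \<in> M" for f g
  proof -
    have "f \<in> L2" "g \<in> L2" "L2_inner (H \<mu>1 \<mu>2 f) g = 0"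
      using that assms L2e_subset_L2
      by (auto simp: closed_subspace_L2e_def invariant_under_def orth_compl_L2e_def)
    then show ?thesis
      by (simp add: L2_inner_H)
  qed
  then have "invariant_under (H \<mu>1 \<mu>2) (orth_compl_L2e M)"
    by (auto simp: invariant_under_def orth_compl_L2e_def L2e_H)
  then show ?thesis
    using assms by (simp add: reduces_def)
qed

section \<open>Subspaces given by permutation relations\<close>

text \<open>
  Each of the three subspaces is cut out of \<open>L2e\<close> by relations
  \<open>f p + a * f (\<sigma> p) + b * f (\<tau> p) = 0\<close> with coordinate permutations \<open>\<sigma>\<close> and \<open>\<tau>\<close>.
\<close>

definition symrel ::
    "complex \<times> (3 \<Rightarrow> 3) \<times> complex \<times> (3 \<Rightarrow> 3) \<Rightarrow> (real^3 \<Rightarrow> complex) \<Rightarrow> real^3 \<Rightarrow> complex" where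
  "symrel = (\<lambda>(a, \<sigma>, b, \<tau>) f p.
     f p + a * f (permute_coords \<sigma> p) + b * f (permute_coords \<tau> p))"

definition symrel_bij :: "complex \<times> (3 \<Rightarrow> 3) \<times> complex \<times> (3 \<Rightarrow> 3) \<Rightarrow> bool" where
  "symrel_bij = (\<lambda>(a, \<sigma>, b, \<tau>). bij \<sigma> \<and> bij \<tau>)"

definition symrel_space :: "(complex \<times> (3 \<Rightarrow> 3) \<times> complex \<times> (3 \<Rightarrow> 3)) set \<Rightarrow> (real^3 \<Rightarrow> complex) set" where
  "symrel_space R = {f \<in> L2e. \<forall>r\<in>R. AE p in torus3. symrel r f p = 0}"

lemma symrel_add: "symrel r (\<lambda>p. f p + g p) p = symrel r f p + symrel r g p"
  by (cases r) (simp add: symrel_def algebra_simps)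

lemma symrel_const_mult: "symrel r (\<lambda>p. c * f p) p = c * symrel r f p"
  by (cases r) (simp add: symrel_def algebra_simps)

lemma L2_symrel:
  assumes "symrel_bij r" "f \<in> L2"
  shows "symrel r f \<in> L2"
proof -
  obtain a \<sigma> b \<tau> where r: "r = (a, \<sigma>, b, \<tau>)"
    by (cases r)
  have "(\<lambda>p. f p + a * f (permute_coords \<sigma> p) + b * f (permute_coords \<tau> p)) \<in> L2"
    using assms by (intro L2_add L2_const_mult L2_permute_coords) (auto simp: r symrel_bij_def)
  then show ?thesis
    by (simp add: r symrel_def)
qed

text \<open>\<open>symrel r\<close> is a linear combination of the identity and two permutation
  operators; \<open>H\<close> is linear and commutes with each of them, as \<open>E0\<close> is
  symmetric and \<open>V\<close> is equivariant.\<close>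

lemma symrel_H:
  assumes "symrel_bij r" "f \<in> L2"
  shows "symrel r (H \<mu>1 \<mu>2 f) = H \<mu>1 \<mu>2 (symrel r f)"
proof
  fix p
  obtain a \<sigma> b \<tau> where r: "r = (a, \<sigma>, b, \<tau>)"
    by (cases r)
  have bij: "bij \<sigma>" "bij \<tau>"
    using assms(1) by (auto simp: r symrel_bij_def)
  have mem: "(\<lambda>p. a * f (permute_coords \<sigma> p)) \<in> L2" "(\<lambda>p. b * f (permute_coords \<tau> p)) \<in> L2"
    "(\<lambda>p. f p + a * f (permute_coords \<sigma> p)) \<in> L2"
    using assms(2) bij by (auto intro!: L2_add L2_const_mult L2_permute_coords)
  have "V \<mu>1 \<mu>2 (symrel r f) p = V \<mu>1 \<mu>2 f p + a * V \<mu>1 \<mu>2 f (permute_coords \<sigma> p)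
      + b * V \<mu>1 \<mu>2 f (permute_coords \<tau> p)"
    using assms(2) bij mem
    by (simp add: r symrel_def[abs_def] V_add V_const_mult V_permute_coords)
  then show "symrel r (H \<mu>1 \<mu>2 f) p = H \<mu>1 \<mu>2 (symrel r f) p"
    using bij by (simp add: r symrel_def H_def H0_def E0_permute_coords algebra_simps)
qed

text \<open>By commutation, \<open>symrel r\<close> of the image is \<open>H\<close> applied to an
  almost everywhere vanishing function: its \<open>H0\<close> part vanishes almost everywhere and
  its \<open>V\<close> part everywhere.\<close>

lemma invariant_under_H_symrel_space:
  assumes "\<And>r. r \<in> R \<Longrightarrow> symrel_bij r"
  shows "invariant_under (H \<mu>1 \<mu>2) (symrel_space R)"
  unfolding invariant_under_def
proof
  fix f assume f: "f \<in> symrel_space R"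
  have "AE p in torus3. symrel r (H \<mu>1 \<mu>2 f) p = 0" if "r \<in> R" for r
  proof -
    have L2: "f \<in> L2" and AE: "AE p in torus3. symrel r f p = 0"
      using f that L2e_subset_L2 by (auto simp: symrel_space_def)
    have "V \<mu>1 \<mu>2 (symrel r f) p = 0" for p
      using L2_symrel[OF assms[OF that] L2] AE by (rule V_eq_zero)
    with AE show ?thesis
      by (auto simp: symrel_H[OF assms[OF that] L2] H_def H0_def)
  qed
  with f show "H \<mu>1 \<mu>2 f \<in> symrel_space R"
    by (simp add: symrel_space_def L2e_H)
qed

text \<open>Boundedness of \<open>symrel r\<close> on \<open>L2\<close>, from the three-term
  inequality and the fact that permuted copies have the same norm. The projections of
  \<open>r\<close> are its two coefficients.\<close>

lemma integral_symrel_le: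
  assumes "symrel_bij r" "f \<in> L2"
  shows "(LINT p|torus3. (cmod (symrel r f p))\<^sup>2) \<le>
    3 * (1 + (cmod (fst r))\<^sup>2 + (cmod (fst (snd (snd r))))\<^sup>2) * (L2_norm f)\<^sup>2"
proof -
  obtain a \<sigma> b \<tau> where r: "r = (a, \<sigma>, b, \<tau>)"
    by (cases r)
  have bij: "bij \<sigma>" "bij \<tau>"
    using assms(1) by (auto simp: r symrel_bij_def)
  let ?I = "LINT p|torus3. (cmod (f p))\<^sup>2"
  note int = L2_integrable_square[OF assms(2)]
  note ints = int integrable_torus3_permute_coords[OF bij(1) int]
    integrable_torus3_permute_coords[OF bij(2) int]
  have "(LINT p|torus3. (cmod (symrel r f p))\<^sup>2) \<le> (LINT p|torus3. 3 * ((cmod (f p))\<^sup>2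
      + (cmod a)\<^sup>2 * (cmod (f (permute_coords \<sigma> p)))\<^sup>2
      + (cmod b)\<^sup>2 * (cmod (f (permute_coords \<tau> p)))\<^sup>2))"
  proof (rule integral_mono)
    show "integrable torus3 (\<lambda>p. (cmod (symrel r f p))\<^sup>2)"
      using L2_symrel[OF assms] by (rule L2_integrable_square)
    show "(cmod (symrel r f p))\<^sup>2 \<le> 3 * ((cmod (f p))\<^sup>2
      + (cmod a)\<^sup>2 * (cmod (f (permute_coords \<sigma> p)))\<^sup>2
      + (cmod b)\<^sup>2 * (cmod (f (permute_coords \<tau> p)))\<^sup>2)" for p
      using cmod_add3_squared_le[of "f p" "a * f (permute_coords \<sigma> p)" "b * f (permute_coords \<tau> p)"]
      by (simp add: r symrel_def norm_mult power_mult_distrib)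
  qed (use ints in auto)
  also have "\<dots> = 3 * (?I + (cmod a)\<^sup>2 * ?I + (cmod b)\<^sup>2 * ?I)"
    using ints integral_torus3_permute_coords[OF bij(1) borel_measurable_integrable[OF int]]
      integral_torus3_permute_coords[OF bij(2) borel_measurable_integrable[OF int]]
    by simp
  finally show ?thesis
    by (simp add: r L2_norm_def algebra_simps)
qed

text \<open>The space is the common kernel of bounded operators. For limits: \<open>symrel r\<close>
  vanishes on each \<open>F n\<close>, so the norm of \<open>symrel r f\<close> is controlled by
  that of \<open>F n - f\<close>, which tends to 0.\<close>

lemma closed_subspace_symrel_space:
  assumes "\<And>r. r \<in> R \<Longrightarrow> symrel_bij r"
  shows "closed_subspace_L2e (symrel_space R)"
  unfolding closed_subspace_L2e_def
proof (intro conjI ballI allI impI; (elim conjE)?)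
  show "symrel_space R \<subseteq> L2e"
    by (auto simp: symrel_space_def)
  show "(\<lambda>p. 0) \<in> symrel_space R"
    by (auto simp: symrel_space_def symrel_def L2e_zero)
  show "(\<lambda>p. f p + g p) \<in> symrel_space R"
    if f: "f \<in> symrel_space R" and g: "g \<in> symrel_space R" for f g
  proof -
    have "AE p in torus3. symrel r (\<lambda>p. f p + g p) p = 0" if "r \<in> R" for r
    proof -
      have "AE p in torus3. symrel r f p = 0" "AE p in torus3. symrel r g p = 0"
        using f g that by (simp_all add: symrel_space_def)
      then show ?thesis
        by eventually_elim (simp add: symrel_add)
    qed
    with f g show ?thesis
      by (simp add: symrel_space_def L2e_add)
  qed
  show "(\<lambda>p. c * f p) \<in> symrel_space R" if "f \<in> symrel_space R" for c f
    using that by (auto simp: symrel_space_def symrel_const_mult L2e_const_mult)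
  fix F f
  assume f: "f \<in> L2e" and F: "\<forall>n. F n \<in> symrel_space R"
    and lim: "(\<lambda>n. L2_norm (\<lambda>p. F n p - f p)) \<longlonglongrightarrow> 0"
  have "AE p in torus3. symrel r f p = 0" if r: "r \<in> R" for r
  proof -
    let ?C = "3 * (1 + (cmod (fst r))\<^sup>2 + (cmod (fst (snd (snd r))))\<^sup>2)"
    let ?I = "LINT p|torus3. (cmod (symrel r f p))\<^sup>2"
    have "?I \<le> ?C * (L2_norm (\<lambda>p. F n p - f p))\<^sup>2" for n
    proof -
      have mem: "f \<in> L2" "F n \<in> L2"
        using f F L2e_subset_L2 by (auto simp: symrel_space_def)
      \<comment> \<open>The difference is written as a sum with factor -1 to fit
        \<open>symrel_add\<close> and \<open>symrel_const_mult\<close>.\<close>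
      then have diff: "(\<lambda>p. F n p + (- 1) * f p) \<in> L2"
        by (intro L2_add L2_const_mult)
      have "AE p in torus3. symrel r (F n) p = 0"
        using F r by (simp add: symrel_space_def)
      then have AE: "AE p in torus3. (cmod (symrel r (\<lambda>p. F n p + (- 1) * f p) p))\<^sup>2 =
          (cmod (symrel r f p))\<^sup>2"
        by eventually_elim (simp only: symrel_add symrel_const_mult, simp)
      have "?I = (LINT p|torus3. (cmod (symrel r (\<lambda>p. F n p + (- 1) * f p) p))\<^sup>2)"
        using AE mem(1) diff
        by (intro integral_cong_AE borel_measurable_integrable L2_integrable_square
            L2_symrel[OF assms[OF r]]) auto
      also have "\<dots> \<le> ?C * (L2_norm (\<lambda>p. F n p + (- 1) * f p))\<^sup>2"
        using integral_symrel_le[OF assms[OF r] diff] .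
      finally show ?thesis
        by simp
    qed
    then have bound: "\<exists>N. \<forall>n\<ge>N. ?I \<le> ?C * (L2_norm (\<lambda>p. F n p - f p))\<^sup>2"
      by blast
    have "(\<lambda>n. ?C * (L2_norm (\<lambda>p. F n p - f p))\<^sup>2) \<longlonglongrightarrow> ?C * 0\<^sup>2"
      by (intro tendsto_intros lim)
    then have "?I \<le> ?C * 0\<^sup>2"
      using bound by (rule LIMSEQ_le_const)
    then have "?I \<le> 0"
      by simp
    moreover have "?I \<ge> 0"
      by simp
    ultimately have "?I = 0"
      by (rule antisym)
    moreover have "integrable torus3 (\<lambda>p. (cmod (symrel r f p))\<^sup>2)"
      using f L2e_subset_L2 by (intro L2_integrable_square L2_symrel[OF assms[OF r]]) auto
    ultimately show ?thesis
      by (simp add: integral_nonneg_eq_0_iff_AE)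
  qed
  with f show "f \<in> symrel_space R"
    by (simp add: symrel_space_def)
qed

section \<open>The three subspaces as relation spaces\<close>

text \<open>A relation with a single permutation has second coefficient 0; \<open>id\<close> is a
  bijective filler for the remaining slot.\<close>

lemma symrel_eq_0_iff:
  "symrel (- 1, \<sigma>, 0, id) f p = 0 \<longleftrightarrow> f (permute_coords \<sigma> p) = f p"
  "symrel (1, \<sigma>, 0, id) f p = 0 \<longleftrightarrow> f p = - f (permute_coords \<sigma> p)"
  by (auto simp: symrel_def eq_neg_iff_add_eq_0)

lemma L2e_s_eq:
  "L2e_s = symrel_space ((\<lambda>\<sigma>. (- 1, \<sigma>, 0, id)) ` {\<sigma>. \<sigma> permutes UNIV})"
  by (simp add: L2e_s_def symrel_space_def symrel_eq_0_iff flip: permute_coords_def)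

lemma L2e_a12_eq: "L2e_a12 = symrel_space {(1, Transposition.transpose 1 2, 0, id)}"
  by (simp add: L2e_a12_def symrel_space_def symrel_eq_0_iff permute_coords_transpose)

text \<open>Transports an almost everywhere statement to the points obtained by swapping two
  coordinates; iterating it reaches the 3-cycles.\<close>

lemma AE_torus3_vector:
  assumes "AE p in torus3. P p"
  shows "AE p in torus3. P (vector [p $ 2, p $ 1, p $ 3])"
    and "AE p in torus3. P (vector [p $ 3, p $ 2, p $ 1])"
    and "AE p in torus3. P (vector [p $ 1, p $ 3, p $ 2])"
  using AE_torus3_permute_coords[OF bij_transpose assms]
  by (simp_all flip: permute_coords_transpose)

lemma vector_3_eta: "vector [p $ 1, p $ 2, p $ 3] = (p :: real^3)"
  by (simp add: vec_eq_iff forall_3)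

text \<open>
  For \<open>f = f1 + f2\<close> as in the definition of \<open>L2e_mix\<close>, the average of \<open>f\<close> over all six
  permutations vanishes; as \<open>f\<close> is symmetric in the first two coordinates, this average is a
  third of \<open>f + f \<circ> (1 3) + f \<circ> (2 3)\<close>.  Conversely this sum being zero gives
  \<open>3 f = (f - f \<circ> (1 3)) + (f - f \<circ> (2 3))\<close>.
\<close>

lemma L2e_mix_eq:
  "L2e_mix = symrel_space
    {(- 1, Transposition.transpose 1 2, 0, id),
     (1, Transposition.transpose 1 3, 1, Transposition.transpose 2 3)}"
    (is "_ = symrel_space {?r, ?s}")
proof (intro equalityI subsetI)
  fix f assume "f \<in> L2e_mix"
  then obtain f1 f2 where f: "f \<in> L2e" "AE p in torus3. f p = f (vector [p $ 2, p $ 1, p $ 3])"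
    and f12: "AE p in torus3. f p = f1 p + f2 p"
      "AE p in torus3. f1 p = - f1 (vector [p $ 3, p $ 2, p $ 1])"
      "AE p in torus3. f2 p = - f2 (vector [p $ 1, p $ 3, p $ 2])"
    by (auto simp: L2e_mix_def)
  \<comment> \<open>All relations are bundled so that they can be moved together to every
    rearrangement of \<open>p\<close>.\<close>
  define P where "P p \<longleftrightarrow> f p = f (vector [p $ 2, p $ 1, p $ 3]) \<and> f p = f1 p + f2 p \<and>
    f1 p = - f1 (vector [p $ 3, p $ 2, p $ 1]) \<and> f2 p = - f2 (vector [p $ 1, p $ 3, p $ 2])" for p
  have P: "AE p in torus3. P p"
    using f(2) f12 by eventually_elim (simp add: P_def)
  note P1 = AE_torus3_vector[OF P]
  \<comment> \<open>The two 3-cycles arise as products of transpositions; with \<open>P\<close> and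
    \<open>P1\<close> all six rearrangements of the coordinates are covered.\<close>
  have P2: "AE p in torus3. P (vector [p $ 3, p $ 1, p $ 2])"
    "AE p in torus3. P (vector [p $ 2, p $ 3, p $ 1])"
    using AE_torus3_vector(1)[OF P1(2)] AE_torus3_vector(2)[OF P1(1)] by simp_all
  have "AE p in torus3. f p + f (vector [p $ 3, p $ 2, p $ 1]) + f (vector [p $ 1, p $ 3, p $ 2]) = 0"
    using P P1 P2
  proof eventually_elim
    case (elim p)
    then show ?case
      \<comment> \<open>What remains is linear algebra in the values of \<open>f\<close>,
        \<open>f1\<close> and \<open>f2\<close> at the six points.\<close>
      unfolding P_def by (simp add: vector_3_eta) algebra
  qed
  then show "f \<in> symrel_space {?r, ?s}"
    using f by (auto simp: symrel_space_def symrel_def permute_coords_transpose)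
next
  fix f assume "f \<in> symrel_space {?r, ?s}"
  then have f: "f \<in> L2e" and sym: "AE p in torus3. f p = f (vector [p $ 2, p $ 1, p $ 3])"
    and sum: "AE p in torus3.
      f p + f (vector [p $ 3, p $ 2, p $ 1]) + f (vector [p $ 1, p $ 3, p $ 2]) = 0"
    by (auto simp: symrel_space_def symrel_def permute_coords_transpose)
  define f1 where "f1 p = 1 / 3 * (f p + (- 1) * f (permute_coords (Transposition.transpose 1 3) p))" for p
  define f2 where "f2 p = 1 / 3 * (f p + (- 1) * f (permute_coords (Transposition.transpose 2 3) p))" for p
  have mem: "f1 \<in> L2e" "f2 \<in> L2e"
    unfolding f1_def[abs_def] f2_def[abs_def] using f
    by (intro L2e_const_mult L2e_add L2e_permute_coords; simp)+
  have "AE p in torus3. f p = f1 p + f2 p"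
    using sum
  proof eventually_elim
    case (elim p)
    then have "f (vector [p $ 3, p $ 2, p $ 1]) = - f p - f (vector [p $ 1, p $ 3, p $ 2])"
      by algebra
    then show ?case
      unfolding f1_def f2_def permute_coords_transpose by (simp only:) (simp add: field_simps)
  qed
  \<comment> \<open>Each swap is an involution and so exchanges the two terms of the difference;
    these identities hold at every point.\<close>
  moreover have "AE p in torus3. f1 p = - f1 (vector [p $ 3, p $ 2, p $ 1])"
    "AE p in torus3. f2 p = - f2 (vector [p $ 1, p $ 3, p $ 2])"
    by (simp_all add: f1_def f2_def permute_coords_transpose vector_3_eta algebra_simps)
  ultimately show "f \<in> L2e_mix"
    unfolding L2e_mix_def using f sym mem by blast
qed

theorem lemma3p2:
  fixes \<mu>1 \<mu>2 :: real
  shows "\<forall>M \<in> {L2e_s, L2e_a12, L2e_mix}.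
           invariant_under (H \<mu>1 \<mu>2) M \<and> reduces M (H \<mu>1 \<mu>2)"
proof
  fix M assume M: "M \<in> {L2e_s, L2e_a12, L2e_mix}"
  \<comment> \<open>Once \<open>M\<close> is known as a relation space with bijective permutations,
    the three cases need no further distinction.\<close>
  obtain R where R: "M = symrel_space R" "\<And>r. r \<in> R \<Longrightarrow> symrel_bij r"
  proof -
    have "\<exists>R. M = symrel_space R \<and> (\<forall>r\<in>R. symrel_bij r)"
      using M unfolding L2e_s_eq L2e_a12_eq L2e_mix_eq
      by (elim insertE emptyE) (auto intro!: exI simp: symrel_bij_def permutes_bij)
    then show thesis
      using that by blast
  qed
  then show "invariant_under (H \<mu>1 \<mu>2) M \<and> reduces M (H \<mu>1 \<mu>2)"
    by (simp add: invariant_under_H_symrel_space closed_subspace_symrel_space reduces_H)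
qed

end
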